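(* Let $F$ be a minimally unsatisfiable clause-set which is eventually saturated, i.e., every element of $\mathrm{sDP}(F)$ is saturated. Then singular DP-reduction is confluent modulo isomorphism on $F$: any two elements $F', F'' \in \mathrm{sDP}(F)$ are isomorphic.
   Context: Literals are variables $v$ and complements $\overline{v}$; a clause is a finite set of literals with no complementary pair; a clause-set is a finite set of clauses; $\mathrm{var}(F)$ is the set of variables of $F$; $\mathrm{ldeg}_F(x)$ is the number of clauses of $F$ containing literal $x$. $\mathrm{DP}_v(F) := \{C \in F : v \notin \mathrm{var}(C)\} \cup \{(C \cup D)\setminus\{v,\overline{v}\} : C, D \in F,\ C \cap \overline{D} = \{v\}\}$. $\mathrm{MU}$ is the set of minimally unsatisfiable clause-sets. $F\in\mathrm{MU}$ is saturated if for every $C \in F$ and every literal $x$ with $\mathrm{var}(x) \in \mathrm{var}(F)\setminus \mathrm{var}(C)$, the clause-set $(F\setminus\{C\})\cup\{C\cup\{x\}\}$ is satisfiable. A variable $v$ is singular for $F$ if $\min(\mathrm{ldeg}_F(v),\mathrm{ldeg}_F(\overline{v}))=1$; $F$ is nonsingular if it has none. A singular DP-reduction step is $F\leadsto \mathrm{DP}_v(F)$ for $F\in\mathrm{MU}$ and $v$ singular for $F$. $\mathrm{sDP}(F)$ is the set of nonsingular $F'\in\mathrm{MU}$ obtainable from $F$ by zero or more singular DP-reduction steps. Clause-sets $F,G$ are isomorphic if there is a bijection on literals commuting with complementation that maps the clauses of $F$ exactly onto the clauses of $G$. *)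

theory Defs
  imports Main
begin

datatype 'v lit = Pos 'v | Neg 'v

fun comp :: "'v lit \<Rightarrow> 'v lit" where
  "comp (Pos v) = Neg v" | "comp (Neg v) = Pos v"

fun lvar :: "'v lit \<Rightarrow> 'v" where
  "lvar (Pos v) = v" | "lvar (Neg v) = v"

type_synonym 'v clause = "'v lit set"
type_synonym 'v cls = "'v clause set"

definition is_clause :: "'v clause \<Rightarrow> bool" where
  "is_clause C \<longleftrightarrow> finite C \<and> (\<forall>x\<in>C. comp x \<notin> C)"

definition is_clause_set :: "'v cls \<Rightarrow> bool" where
  "is_clause_set F \<longleftrightarrow> finite F \<and> (\<forall>C\<in>F. is_clause C)"

definition vars_cl :: "'v clause \<Rightarrow> 'v set" where
  "vars_cl C = lvar ` C"

definition vars :: "'v cls \<Rightarrow> 'v set" where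
  "vars F = (\<Union>C\<in>F. vars_cl C)"

definition ldeg :: "'v cls \<Rightarrow> 'v lit \<Rightarrow> nat" where
  "ldeg F x = card {C \<in> F. x \<in> C}"

fun lit_val :: "('v \<Rightarrow> bool) \<Rightarrow> 'v lit \<Rightarrow> bool" where
  "lit_val \<phi> (Pos v) = \<phi> v" | "lit_val \<phi> (Neg v) = (\<not> \<phi> v)"

definition satisfiable :: "'v cls \<Rightarrow> bool" where
  "satisfiable F \<longleftrightarrow> (\<exists>\<phi>. \<forall>C\<in>F. \<exists>x\<in>C. lit_val \<phi> x)"

definition MU :: "'v cls \<Rightarrow> bool" where
  "MU F \<longleftrightarrow> is_clause_set F \<and> \<not> satisfiable F \<and> (\<forall>C\<in>F. satisfiable (F - {C}))"

definition DP :: "'v \<Rightarrow> 'v cls \<Rightarrow> 'v cls" where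
  "DP v F = {C \<in> F. v \<notin> vars_cl C}
     \<union> {(C \<union> D) - {Pos v, Neg v} | C D. C \<in> F \<and> D \<in> F \<and> C \<inter> comp ` D = {Pos v}}"

definition saturated :: "'v cls \<Rightarrow> bool" where
  "saturated F \<longleftrightarrow> MU F \<and>
     (\<forall>C\<in>F. \<forall>x. lvar x \<in> vars F - vars_cl C \<longrightarrow> satisfiable ((F - {C}) \<union> {C \<union> {x}}))"

definition singular :: "'v cls \<Rightarrow> 'v \<Rightarrow> bool" where
  "singular F v \<longleftrightarrow> min (ldeg F (Pos v)) (ldeg F (Neg v)) = 1"

definition nonsingular :: "'v cls \<Rightarrow> bool" where
  "nonsingular F \<longleftrightarrow> (\<forall>v. \<not> singular F v)"

definition sDP_step :: "'v cls \<Rightarrow> 'v cls \<Rightarrow> bool" where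
  "sDP_step F G \<longleftrightarrow> MU F \<and> (\<exists>v. singular F v \<and> G = DP v F)"

definition sDP :: "'v cls \<Rightarrow> 'v cls set" where
  "sDP F = {F'. sDP_step\<^sup>*\<^sup>* F F' \<and> nonsingular F' \<and> MU F'}"

definition isomorphic :: "'v cls \<Rightarrow> 'v cls \<Rightarrow> bool" where
  "isomorphic F G \<longleftrightarrow> (\<exists>f. bij f \<and> (\<forall>x. f (comp x) = comp (f x)) \<and> (\<lambda>C. f ` C) ` F = G)"

end

theory Submission
  imports Defs
begin

text \<open>
  Induct on the number of variables, comparing two singular reductions on \<open>v\<close> and \<open>w\<close>.
  Up to subsumption DP-reductions commute, and minimally unsatisfiable clause-sets contain no
  subsumed clauses, so \<open>v\<close> and \<open>w\<close> can be joined whenever each stays singular after reducing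
  the other. This fails only if the literals \<open>x\<close>, \<open>y\<close> of degree one over \<open>v\<close>, \<open>w\<close> lie in the same
  clause \<open>C\<close> and both complements have degree at least two. If then some variable \<open>u\<close> is still
  singular after one of the reductions, it was already singular and it can be joined with both \<open>v\<close>
  and \<open>w\<close>, which gives a common descendant up to the induction hypothesis. Otherwise both
  reducts are nonsingular, hence saturated; saturation forces \<open>C - {x, y}\<close> to be contained in all
  clauses containing the complement of \<open>x\<close> or of \<open>y\<close>, and then exchanging \<open>y\<close> with the complement
  of \<open>x\<close> is an isomorphism between the two reducts.
\<close>

section \<open>Literals, clashes and assignments\<close>

lemma comp_comp [simp]: "comp (comp x) = x"
  by (cases x) auto

lemma lvar_comp [simp]: "lvar (comp x) = lvar x"
  by (cases x) auto

lemma comp_neq [simp]: "comp x \<noteq> x" "x \<noteq> comp x"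
  by (cases x; simp)+

lemma comp_eq_iff [simp]: "comp x = comp y \<longleftrightarrow> x = y"
  by (metis comp_comp)

lemma comp_eq_comp_swap: "comp x = y \<longleftrightarrow> x = comp y"
  by auto

lemma lvar_eq_iff: "lvar x = lvar y \<longleftrightarrow> x = y \<or> x = comp y"
  by (cases x; cases y) auto

lemma lit_val_comp [simp]: "lit_val \<phi> (comp x) \<longleftrightarrow> \<not> lit_val \<phi> x"
  by (cases x) auto

lemma lvar_in_vars_cl: "lvar x \<in> vars_cl C \<longleftrightarrow> x \<in> C \<or> comp x \<in> C"
  unfolding vars_cl_def by (auto simp: image_iff) (metis lvar_eq_iff lvar_comp)+

lemma mem_comp_image [simp]: "x \<in> comp ` D \<longleftrightarrow> comp x \<in> D"
  by (metis comp_comp image_iff)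

lemma clash_iff:
  "C \<inter> comp ` D = {x} \<longleftrightarrow> x \<in> C \<and> comp x \<in> D \<and> (\<forall>z\<in>C. comp z \<in> D \<longrightarrow> z = x)"
proof -
  have "C \<inter> comp ` D = {z \<in> C. comp z \<in> D}" by auto
  then show ?thesis by (simp only: set_eq_iff) auto
qed

text \<open>Lets the value of one literal be changed without splitting on its sign in later
  arguments.\<close>

lemma assignment_set_literal:
  obtains \<psi> where "lit_val \<psi> x" "\<And>z. lvar z \<noteq> lvar x \<Longrightarrow> lit_val \<psi> z = lit_val \<phi> z"
proof (cases x)
  case (Pos v)
  have "lit_val (\<phi>(v := True)) z = lit_val \<phi> z" if "lvar z \<noteq> lvar x" for z
    using that Pos by (cases z) auto
  then show ?thesis using that[of "\<phi>(v := True)"] Pos by simp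
next
  case (Neg v)
  have "lit_val (\<phi>(v := False)) z = lit_val \<phi> z" if "lvar z \<noteq> lvar x" for z
    using that Neg by (cases z) auto
  then show ?thesis using that[of "\<phi>(v := False)"] Neg by simp
qed

section \<open>Minimally unsatisfiable clause-sets\<close>

lemma MU_finite: "MU F \<Longrightarrow> finite F"
  by (simp add: MU_def is_clause_set_def)

lemma MU_is_clause_set: "MU F \<Longrightarrow> is_clause_set F"
  by (simp add: MU_def)

lemma clause_set_no_clash: "is_clause_set F \<Longrightarrow> C \<in> F \<Longrightarrow> x \<in> C \<Longrightarrow> comp x \<notin> C"
  by (auto simp: is_clause_set_def is_clause_def)

text \<open>An assignment satisfying everything but \<open>D\<close> satisfies \<open>C\<close>,
  hence also the larger clause \<open>D\<close>, and thus all of \<open>F\<close>.\<close>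

lemma MU_subsumption_free:
  assumes "MU F" "C \<in> F" "D \<in> F" "C \<subseteq> D"
  shows "C = D"
proof (rule ccontr)
  assume "C \<noteq> D"
  obtain \<phi> where \<phi>: "\<forall>E\<in>F - {D}. \<exists>z\<in>E. lit_val \<phi> z"
    using assms unfolding MU_def satisfiable_def by meson
  then have "\<forall>E\<in>F. \<exists>z\<in>E. lit_val \<phi> z"
    using assms \<open>C \<noteq> D\<close> by (metis DiffI singletonD subsetD)
  then show False using assms(1) unfolding MU_def satisfiable_def by blast
qed

section \<open>DP-reduction\<close>

text \<open>Makes DP-reduction sign-neutral: \<open>x\<close> may be either literal of the
  eliminated variable, since exchanging the two parents complements the clashing literal.\<close>

lemma DP_lvar:
  "DP (lvar x) F = {C \<in> F. x \<notin> C \<and> comp x \<notin> C}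
     \<union> {(C \<union> D) - {x, comp x} | C D. C \<in> F \<and> D \<in> F \<and> C \<inter> comp ` D = {x}}"
proof (cases x)
  case (Pos v)
  then show ?thesis unfolding DP_def using lvar_in_vars_cl[of "Pos v"] by auto
next
  case (Neg v)
  have swap: "C \<inter> comp ` D = {Pos v} \<longleftrightarrow> D \<inter> comp ` C = {Neg v}" for C D :: "'a clause"
  proof -
    have "D \<inter> comp ` C = comp ` (C \<inter> comp ` D)" by (force simp: image_iff)
    moreover have "C \<inter> comp ` D = comp ` (D \<inter> comp ` C)" by (force simp: image_iff)
    ultimately show ?thesis by (metis comp.simps image_empty image_insert)
  qed
  have comm: "(C \<union> D) - {Pos v, Neg v} = (D \<union> C) - {Neg v, Pos v}" for C D :: "'a clause"
    by blast
  have "{(C \<union> D) - {Pos v, Neg v} | C D. C \<in> F \<and> D \<in> F \<and> D \<inter> comp ` C = {Neg v}}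
      = {(C \<union> D) - {Neg v, Pos v} | C D. C \<in> F \<and> D \<in> F \<and> C \<inter> comp ` D = {Neg v}}"
    unfolding comm by blast
  moreover have "{C \<in> F. v \<notin> vars_cl C} = {C \<in> F. x \<notin> C \<and> comp x \<notin> C}"
    using lvar_in_vars_cl[of x] Neg by auto
  ultimately show ?thesis by (simp add: Neg DP_def swap)
qed

lemma DP_cases:
  assumes "A \<in> DP (lvar x) F"
  obtains (old) "A \<in> F" "x \<notin> A" "comp x \<notin> A"
  | (res) C D where "C \<in> F" "D \<in> F" "C \<inter> comp ` D = {x}" "A = (C \<union> D) - {x, comp x}"
  using assms unfolding DP_lvar by blast

lemma DP_oldI: "A \<in> F \<Longrightarrow> x \<notin> A \<Longrightarrow> comp x \<notin> A \<Longrightarrow> A \<in> DP (lvar x) F"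
  unfolding DP_lvar by blast

lemma DP_resI:
  "C \<in> F \<Longrightarrow> D \<in> F \<Longrightarrow> C \<inter> comp ` D = {x} \<Longrightarrow> (C \<union> D) - {x, comp x} \<in> DP (lvar x) F"
  unfolding DP_lvar by blast

lemma DP_lit_notin:
  assumes "A \<in> DP (lvar x) F"
  shows "x \<notin> A"
  using assms by (cases rule: DP_cases) auto

lemma is_clause_set_DP:
  assumes "is_clause_set F"
  shows "is_clause_set (DP v F)"
proof -
  have "DP v F \<subseteq> F \<union> (\<lambda>(C, D). (C \<union> D) - {Pos v, Neg v}) ` (F \<times> F)"
    unfolding DP_def by auto
  then have "finite (DP v F)"
    by (rule finite_subset) (use assms in \<open>auto simp: is_clause_set_def\<close>)
  moreover have "is_clause A" if "A \<in> DP v F" for A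
  proof -
    have "A \<in> DP (lvar (Pos v)) F" using that by simp
    then show ?thesis
    proof (cases rule: DP_cases)
      case old
      then show ?thesis using assms by (simp add: is_clause_set_def)
    next
      case (res C D)
      have "finite A" using res assms by (auto simp: is_clause_set_def is_clause_def)
      moreover have "comp z \<notin> A" if z: "z \<in> A" for z
      proof
        assume cz: "comp z \<in> A"
        \<comment> \<open>The only clash between the parents is deleted, so a complementary pair in
          the resolvent would have to lie within one parent.\<close>
        have "u = Pos v" if "u \<in> C" "comp u \<in> D" for u
          using that res(3) by (simp add: clash_iff)
        then have "\<not> (z \<in> C \<and> comp z \<in> D)" "\<not> (comp z \<in> C \<and> z \<in> D)"
          using res(4) z cz by fastforce+
        then show False
          using res z cz clause_set_no_clash[OF assms] by blast
      qed
      ultimately show ?thesis by (simp add: is_clause_def)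
    qed
  qed
  ultimately show ?thesis by (simp add: is_clause_set_def)
qed

text \<open>Used to pull clauses back through a reduction: by sign-neutrality the parent of a
  resolvent can be chosen on the side of the prescribed literal \<open>l\<close>.\<close>

lemma DP_parent:
  assumes "is_clause_set F" "A \<in> DP (lvar l) F"
  shows "(A \<in> F \<and> l \<notin> A \<and> comp l \<notin> A) \<or> (\<exists>A'\<in>F. l \<in> A' \<and> A' \<subseteq> insert l A)"
  using assms(2)
proof (cases rule: DP_cases)
  case old
  then show ?thesis by simp
next
  case (res C D)
  have "l \<in> C" using res(3) by (simp add: clash_iff)
  moreover have "comp l \<notin> C" using clause_set_no_clash assms(1) res \<open>l \<in> C\<close> by blast
  ultimately show ?thesis using res by blast
qed

text \<open>A second clash between \<open>A\<close> and \<open>B\<close> would be a complementary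
  pair in the clause \<open>P\<close>, so the two are resolvable.\<close>

lemma DP_resolve_subset:
  assumes "A \<in> F" "B \<in> F" "x \<in> A" "comp x \<in> B"
    and "A \<subseteq> insert x P" "B \<subseteq> insert (comp x) P"
    and "is_clause P" "x \<notin> P" "comp x \<notin> P"
  shows "\<exists>Q\<in>DP (lvar x) F. Q \<subseteq> P"
proof -
  have "z = x" if "z \<in> A" "comp z \<in> B" for z
  proof -
    have "z = x \<or> z \<in> P" "comp z = comp x \<or> comp z \<in> P" using that assms by blast+
    then show ?thesis using assms(7) by (auto simp: is_clause_def)
  qed
  then have "A \<inter> comp ` B = {x}" using assms(3,4) unfolding clash_iff by blast
  then have "(A \<union> B) - {x, comp x} \<in> DP (lvar x) F" by (rule DP_resI[OF assms(1,2)])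
  moreover have "(A \<union> B) - {x, comp x} \<subseteq> P" using assms(5,6) by auto
  ultimately show ?thesis by blast
qed

text \<open>
  Lifting a \<open>w\<close>-resolvent \<open>P\<close> of two clauses \<open>A\<close>, \<open>B\<close> of \<open>DP v F\<close> to the \<open>l\<close>-parents \<open>A'\<close>, \<open>B'\<close>:
  either a parent does not contain the resolved literal and survives itself, or the two parents
  can be resolved on \<open>w\<close>.
\<close>

lemma DP_lift_resolvent:
  assumes A: "is_clause A" "l \<notin> A" "comp l \<notin> A" and B: "is_clause B" "l \<notin> B" "comp l \<notin> B"
    and AB: "A \<inter> comp ` B = {y}" and ly: "lvar l \<noteq> lvar y"
    and A': "A' \<in> F" "A' \<subseteq> insert l A" "l \<in> A' \<or> y \<in> A'"
    and B': "B' \<in> F" "B' \<subseteq> insert l B" "l \<in> B' \<or> comp y \<in> B'"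
    and l: "l \<in> A' \<or> l \<in> B'"
  shows "\<exists>Q\<in>DP (lvar y) F. l \<in> Q \<and> Q \<subseteq> insert l ((A \<union> B) - {y, comp y})"
proof -
  have y: "y \<in> A" "comp y \<in> B" "comp y \<notin> A" "y \<notin> B"
    using AB A(1) B(1) unfolding clash_iff is_clause_def by auto
  have ly': "l \<noteq> y" "l \<noteq> comp y" using ly by auto
  consider "l \<in> A'" "y \<notin> A'" | "l \<in> B'" "comp y \<notin> B'" | "y \<in> A'" "comp y \<in> B'"
    using A' B' l by blast
  then show ?thesis
  proof cases
    case 1
    then have "A' \<in> DP (lvar y) F" using A' y ly' by (intro DP_oldI) auto
    then show ?thesis using 1 A' y by blast
  next
    case 2
    then have "B' \<in> DP (lvar y) F" using B' y ly' by (intro DP_oldI) auto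
    then show ?thesis using 2 B' y by blast
  next
    case 3
    have "z = y" if "z \<in> A'" "comp z \<in> B'" for z
    proof -
      have "z = l \<or> z \<in> A" "comp z = l \<or> comp z \<in> B" using that A' B' by auto
      then have "z \<in> A" "comp z \<in> B" using A B by (auto simp: comp_eq_comp_swap)
      then show ?thesis using AB by (simp add: clash_iff)
    qed
    then have "A' \<inter> comp ` B' = {y}" using 3 unfolding clash_iff by blast
    then have "(A' \<union> B') - {y, comp y} \<in> DP (lvar y) F" by (rule DP_resI[OF A'(1) B'(1)])
    moreover have "l \<in> (A' \<union> B') - {y, comp y}" using l ly' by auto
    moreover have "(A' \<union> B') - {y, comp y} \<subseteq> insert l ((A \<union> B) - {y, comp y})"
      using A'(2) B'(2) by auto
    ultimately show ?thesis by (intro bexI conjI)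
  qed
qed

text \<open>Either no resolution on the variable of \<open>x\<close> went into \<open>P\<close>, and
  then \<open>P\<close> also arises in the other order, or for both literals \<open>l\<close> of
  that variable the reduct on \<open>y\<close> has a clause containing \<open>l\<close> and
  otherwise inside \<open>P\<close>. Resolving these two gives \<open>Q\<close>.\<close>

lemma DP_DP_subsumed:
  assumes F: "is_clause_set F" and xy: "lvar x \<noteq> lvar y"
    and P: "P \<in> DP (lvar y) (DP (lvar x) F)"
  shows "\<exists>Q\<in>DP (lvar x) (DP (lvar y) F). Q \<subseteq> P"
proof -
  let ?G = "DP (lvar x) F"
  have G: "is_clause_set ?G" by (rule is_clause_set_DP[OF F])
  have clP: "is_clause P" using is_clause_set_DP[OF G] P by (simp add: is_clause_set_def)
  have notin: "x \<notin> A \<and> comp x \<notin> A" if "A \<in> ?G" for A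
    using that DP_lit_notin[of A x] DP_lit_notin[of A "comp x"] by simp
  have xP: "x \<notin> P \<and> comp x \<notin> P"
    using P by (cases rule: DP_cases) (use notin in auto)
  have "P \<in> DP (lvar x) (DP (lvar y) F) \<or>
      (\<forall>l. lvar l = lvar x \<longrightarrow> (\<exists>Q\<in>DP (lvar y) F. l \<in> Q \<and> Q \<subseteq> insert l P))"
    using P
  proof (cases rule: DP_cases)
    case old
    show ?thesis
    proof (cases "P \<in> F")
      case True
      then show ?thesis using old xP by (auto intro!: DP_oldI)
    next
      case False
      \<comment> \<open>Here \<open>P\<close> is a resolvent on \<open>x\<close>; its parent with
        \<open>l\<close> contains neither \<open>y\<close> nor \<open>comp y\<close> and so survives
        the reduction on \<open>y\<close>.\<close>
      have "\<exists>Q\<in>DP (lvar y) F. l \<in> Q \<and> Q \<subseteq> insert l P" if l: "lvar l = lvar x" for l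
      proof -
        obtain A' where A': "A' \<in> F" "l \<in> A'" "A' \<subseteq> insert l P"
          using DP_parent[OF F, of P l] l old False by auto
        have "y \<noteq> l" "comp y \<noteq> l" using l xy by auto
        then have "A' \<in> DP (lvar y) F" using A' old by (intro DP_oldI) auto
        then show ?thesis using A' by blast
      qed
      then show ?thesis by blast
    qed
  next
    case (res A B)
    have cl: "is_clause A" "is_clause B" using res G by (auto simp: is_clause_set_def)
    show ?thesis
    proof (cases "A \<in> F \<and> B \<in> F")
      case True
      then have "P \<in> DP (lvar y) F" using res DP_resI by metis
      then show ?thesis using xP by (auto intro!: DP_oldI)
    next
      case False
      have "\<exists>Q\<in>DP (lvar y) F. l \<in> Q \<and> Q \<subseteq> insert l P" if l: "lvar l = lvar x" for l
      proof -
        have y: "y \<in> A" "comp y \<in> B" using res(3) by (simp_all add: clash_iff)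
        have nA: "l \<notin> A" "comp l \<notin> A" and nB: "l \<notin> B" "comp l \<notin> B"
          using notin res l by (auto simp: lvar_eq_iff)
        obtain A' where A': "A' \<in> F" "A' \<subseteq> insert l A" "l \<in> A' \<or> A' = A"
          using DP_parent[OF F, of A l] l res by fastforce
        obtain B' where B': "B' \<in> F" "B' \<subseteq> insert l B" "l \<in> B' \<or> B' = B"
          using DP_parent[OF F, of B l] l res by fastforce
        \<comment> \<open>At least one of \<open>A\<close>, \<open>B\<close> is itself a resolvent
          on \<open>x\<close> and thus has a parent containing \<open>l\<close>.\<close>
        have "l \<in> A' \<or> l \<in> B'" using A' B' False by blast
        then show ?thesis
          using DP_lift_resolvent[OF cl(1) nA cl(2) nB res(3) _ A'(1,2) _ B'(1,2)] res y A' B' l xy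
          by auto
      qed
      then show ?thesis by blast
    qed
  qed
  then show ?thesis
  proof
    assume *: "\<forall>l. lvar l = lvar x \<longrightarrow> (\<exists>Q\<in>DP (lvar y) F. l \<in> Q \<and> Q \<subseteq> insert l P)"
    obtain Q1 where "Q1 \<in> DP (lvar y) F" "x \<in> Q1" "Q1 \<subseteq> insert x P" using * by blast
    moreover obtain Q2 where "Q2 \<in> DP (lvar y) F" "comp x \<in> Q2" "Q2 \<subseteq> insert (comp x) P"
      using *[rule_format, of "comp x"] by auto
    ultimately show ?thesis using DP_resolve_subset clP xP by meson
  qed blast
qed

text \<open>Subsuming back and forth yields \<open>P'\<close> \<subseteq> \<open>Q\<close>
  \<subseteq> \<open>P\<close> with \<open>P'\<close> and \<open>P\<close> in the same minimally
  unsatisfiable set, so all three coincide.\<close>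

lemma DP_commute_MU:
  assumes "is_clause_set F" "lvar x \<noteq> lvar y"
    and "MU (DP (lvar y) (DP (lvar x) F))" "MU (DP (lvar x) (DP (lvar y) F))"
  shows "DP (lvar y) (DP (lvar x) F) = DP (lvar x) (DP (lvar y) F)"
proof -
  have "DP (lvar b) (DP (lvar a) F) \<subseteq> DP (lvar a) (DP (lvar b) F)"
    if ab: "lvar a \<noteq> lvar b" "MU (DP (lvar b) (DP (lvar a) F))" for a b
  proof
    fix P assume P: "P \<in> DP (lvar b) (DP (lvar a) F)"
    obtain Q where Q: "Q \<in> DP (lvar a) (DP (lvar b) F)" "Q \<subseteq> P"
      using DP_DP_subsumed[OF assms(1) ab(1) P] by blast
    obtain P' where P': "P' \<in> DP (lvar b) (DP (lvar a) F)" "P' \<subseteq> Q"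
      using DP_DP_subsumed[OF assms(1) ab(1)[symmetric] Q(1)] by blast
    have "P' = P" using MU_subsumption_free[OF ab(2) P'(1) P] P' Q by blast
    then show "P \<in> DP (lvar a) (DP (lvar b) F)" using P' Q by simp
  qed
  then show ?thesis using assms by (metis subset_antisym)
qed

section \<open>Singular literals\<close>

text \<open>Singularity stated for a literal instead of a variable: \<open>x\<close> is the literal
  of degree one, \<open>C\<close> its sole occurrence. The second conjunct excludes pure literals,
  for which the minimum of the two degrees would be 0. The clauses with \<open>comp x\<close> are
  called side clauses below.\<close>

definition main_clause :: "'v cls \<Rightarrow> 'v lit \<Rightarrow> 'v clause \<Rightarrow> bool" where
  "main_clause F x C \<longleftrightarrow> {E \<in> F. x \<in> E} = {C} \<and> (\<exists>D\<in>F. comp x \<in> D)"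

lemma main_clauseD:
  assumes "main_clause F x C"
  shows "C \<in> F" "x \<in> C" "\<And>E. E \<in> F \<Longrightarrow> x \<in> E \<Longrightarrow> E = C"
  using assms unfolding main_clause_def by auto

lemma singular_iff_main_clause:
  assumes "finite F"
  shows "singular F v \<longleftrightarrow> (\<exists>x C. lvar x = v \<and> main_clause F x C)"
proof -
  have one: "ldeg F x = 1 \<longleftrightarrow> (\<exists>C. {E \<in> F. x \<in> E} = {C})" for x
    unfolding ldeg_def by (simp add: card_1_singleton_iff)
  have pos: "ldeg F x \<ge> 1 \<longleftrightarrow> (\<exists>D\<in>F. x \<in> D)" for x
    unfolding ldeg_def using assms by (auto simp: Suc_le_eq card_gt_0_iff)
  have "singular F v \<longleftrightarrow>
      (ldeg F (Pos v) = 1 \<and> ldeg F (Neg v) \<ge> 1) \<or> (ldeg F (Neg v) = 1 \<and> ldeg F (Pos v) \<ge> 1)"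
    unfolding singular_def min_def by auto
  also have "\<dots> \<longleftrightarrow> (\<exists>C. main_clause F (Pos v) C) \<or> (\<exists>C. main_clause F (Neg v) C)"
    unfolding one pos main_clause_def by auto
  also have "\<dots> \<longleftrightarrow> (\<exists>x C. lvar x = v \<and> main_clause F x C)"
    by (metis lvar.simps lit.exhaust)
  finally show ?thesis .
qed

text \<open>
  Flipping \<open>x\<close> to false would satisfy all of \<open>F\<close> unless it falsifies the main clause.
\<close>

lemma main_clause_witness:
  assumes MU: "MU F" and x: "main_clause F x C" and D: "D \<in> F" "comp x \<in> D"
  obtains \<phi> where "\<And>E. E \<in> F \<Longrightarrow> E \<noteq> D \<Longrightarrow> \<exists>z\<in>E. lit_val \<phi> z"
    and "\<And>z. z \<in> D \<Longrightarrow> \<not> lit_val \<phi> z" and "\<And>z. z \<in> C \<Longrightarrow> z \<noteq> x \<Longrightarrow> \<not> lit_val \<phi> z"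
proof -
  have unsat: "\<not> (\<forall>E\<in>F. \<exists>z\<in>E. lit_val \<phi> z)" for \<phi>
    using MU unfolding MU_def satisfiable_def by blast
  have "satisfiable (F - {D})" using MU D unfolding MU_def by blast
  then obtain \<phi> where \<phi>: "\<And>E. E \<in> F \<Longrightarrow> E \<noteq> D \<Longrightarrow> \<exists>z\<in>E. lit_val \<phi> z"
    unfolding satisfiable_def by auto
  moreover have fD: "\<not> lit_val \<phi> z" if "z \<in> D" for z using unsat[of \<phi>] \<phi> that by blast
  moreover have "\<not> lit_val \<phi> z" if z: "z \<in> C" "z \<noteq> x" for z
  proof
    assume zt: "lit_val \<phi> z"
    obtain \<psi> where \<psi>: "lit_val \<psi> (comp x)" "\<And>z. lvar z \<noteq> lvar x \<Longrightarrow> lit_val \<psi> z = lit_val \<phi> z"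
      by (rule assignment_set_literal[of "comp x" \<phi>]) simp
    have "comp x \<notin> C"
      using clause_set_no_clash[OF MU_is_clause_set[OF MU]] main_clauseD[OF x] by blast
    then have "lvar z \<noteq> lvar x" using z by (auto simp: lvar_eq_iff)
    then have "lit_val \<psi> z" using \<psi> zt by simp
    have "\<exists>u\<in>E. lit_val \<psi> u" if E: "E \<in> F" for E
    proof -
      consider "x \<in> E" | "comp x \<in> E" | "x \<notin> E" "comp x \<notin> E" by blast
      then show ?thesis
      proof cases
        case 1
        then show ?thesis using main_clauseD(3)[OF x E] z \<open>lit_val \<psi> z\<close> by blast
      next
        case 2
        then show ?thesis using \<psi> by blast
      next
        case 3
        then obtain u where "u \<in> E" "lit_val \<phi> u" using \<phi>[OF E] D by blast
        then show ?thesis using 3 \<psi>(2)[of u] by (auto simp: lvar_eq_iff)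
      qed
    qed
    then show False using unsat by blast
  qed
  ultimately show ?thesis using that by blast
qed

text \<open>At a second clash \<open>z\<close> the witnessing assignment would falsify both
  \<open>z\<close> and \<open>comp z\<close>.\<close>

lemma main_clause_clash:
  assumes "MU F" "main_clause F x C" "D \<in> F" "comp x \<in> D"
  shows "C \<inter> comp ` D = {x}"
proof (rule main_clause_witness[OF assms])
  fix \<phi> assume "\<And>z. z \<in> D \<Longrightarrow> \<not> lit_val \<phi> z" "\<And>z. z \<in> C \<Longrightarrow> z \<noteq> x \<Longrightarrow> \<not> lit_val \<phi> z"
  then show ?thesis using assms(4) main_clauseD(2)[OF assms(2)] unfolding clash_iff by fastforce
qed

text \<open>The witness for \<open>D\<close> falsifies the resolvent with \<open>D\<close>, but a
  distinct side clause \<open>D'\<close> has a true literal, which is not \<open>comp x\<close> and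
  therefore remains in its resolvent.\<close>

lemma main_clause_resolvent_inj:
  assumes "MU F" "main_clause F x C" "D \<in> F" "comp x \<in> D" "D' \<in> F" "comp x \<in> D'"
    and "(C \<union> D) - {x, comp x} = (C \<union> D') - {x, comp x}"
  shows "D = D'"
proof (rule ccontr, rule main_clause_witness[OF assms(1-4)])
  fix \<phi> assume "D \<noteq> D'" and \<phi>: "\<And>E. E \<in> F \<Longrightarrow> E \<noteq> D \<Longrightarrow> \<exists>z\<in>E. lit_val \<phi> z"
    and D: "\<And>z. z \<in> D \<Longrightarrow> \<not> lit_val \<phi> z" and C: "\<And>z. z \<in> C \<Longrightarrow> z \<noteq> x \<Longrightarrow> \<not> lit_val \<phi> z"
  obtain z where z: "z \<in> D'" "lit_val \<phi> z" using \<phi>[OF assms(5)] \<open>D \<noteq> D'\<close> by blast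
  have "x \<notin> D'" using clause_set_no_clash[OF MU_is_clause_set] assms(1,5,6) by blast
  then have "z \<in> (C \<union> D') - {x, comp x}" using z D[OF assms(4)] by auto
  then have "z \<in> (C \<union> D) - {x, comp x}" using assms(7) by simp
  then show False using z C D by blast
qed

text \<open>The witness for \<open>D\<close> falsifies the resolvent but satisfies every clause of
  \<open>F\<close> other than \<open>D\<close>, while the resolvent lacks \<open>comp x\<close> and
  so differs from \<open>D\<close>.\<close>

lemma main_clause_resolvent_new:
  assumes "MU F" "main_clause F x C" "D \<in> F" "comp x \<in> D"
  shows "(C \<union> D) - {x, comp x} \<notin> F"
proof (rule notI, rule main_clause_witness[OF assms])
  fix \<phi> assume F: "(C \<union> D) - {x, comp x} \<in> F"
    and \<phi>: "\<And>E. E \<in> F \<Longrightarrow> E \<noteq> D \<Longrightarrow> \<exists>z\<in>E. lit_val \<phi> z"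
    and D: "\<And>z. z \<in> D \<Longrightarrow> \<not> lit_val \<phi> z" and C: "\<And>z. z \<in> C \<Longrightarrow> z \<noteq> x \<Longrightarrow> \<not> lit_val \<phi> z"
  have "(C \<union> D) - {x, comp x} \<noteq> D" using assms by blast
  then show False using \<phi>[OF F] C D by blast
qed

text \<open>The first parent can only be \<open>C\<close>, and every side clause is resolvable with
  it by \<open>main_clause_clash\<close>.\<close>

lemma DP_main_clause:
  assumes "MU F" "main_clause F x C"
  shows "DP (lvar x) F = {E \<in> F. x \<notin> E \<and> comp x \<notin> E}
    \<union> (\<lambda>D. (C \<union> D) - {x, comp x}) ` {D \<in> F. comp x \<in> D}" (is "_ = ?R")
proof (intro equalityI subsetI)
  fix A assume "A \<in> DP (lvar x) F"
  then show "A \<in> ?R"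
  proof (cases rule: DP_cases)
    case (res B D)
    have "x \<in> B" "comp x \<in> D" using res(3) by (simp_all add: clash_iff)
    moreover have "B = C" using main_clauseD(3)[OF assms(2) res(1)] \<open>x \<in> B\<close> .
    ultimately show ?thesis using res(2,4) by blast
  qed auto
next
  fix A assume "A \<in> ?R"
  then show "A \<in> DP (lvar x) F"
    using DP_resI[OF main_clauseD(1)[OF assms(2)] _ main_clause_clash[OF assms]]
    by (auto intro: DP_oldI)
qed

text \<open>A model of the reduct extends to \<open>F\<close> by choosing the value of
  \<open>x\<close> suitably. Conversely, removing an old clause or the resolvent with
  \<open>D\<close> is handled by a model of \<open>F\<close> without that clause or without
  \<open>D\<close>.\<close>

lemma MU_DP_main_clause:
  assumes MU: "MU F" and x: "main_clause F x C"
  shows "MU (DP (lvar x) F)"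
proof -
  let ?G = "DP (lvar x) F"
  let ?r = "\<lambda>D. (C \<union> D) - {x, comp x}"
  have unsat: "\<not> (\<forall>E\<in>F. \<exists>z\<in>E. lit_val \<phi> z)" for \<phi>
    using MU unfolding MU_def satisfiable_def by blast
  note G = DP_main_clause[OF MU x]
  note C = main_clauseD[OF x]
  have noclash: "z \<in> E \<Longrightarrow> comp z \<notin> E" if "E \<in> F" for E z
    using clause_set_no_clash[OF MU_is_clause_set[OF MU]] that by blast
  have "\<not> satisfiable ?G"
  proof
    assume "satisfiable ?G"
    then obtain \<phi> where \<phi>: "\<And>E. E \<in> ?G \<Longrightarrow> \<exists>z\<in>E. lit_val \<phi> z"
      unfolding satisfiable_def by blast
    obtain \<psi> where p: "lit_val \<psi> x" "\<And>z. lvar z \<noteq> lvar x \<Longrightarrow> lit_val \<psi> z = lit_val \<phi> z"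
      by (rule assignment_set_literal[of x \<phi>]) simp
    obtain \<chi> where n: "lit_val \<chi> (comp x)" "\<And>z. lvar z \<noteq> lvar x \<Longrightarrow> lit_val \<chi> z = lit_val \<phi> z"
      by (rule assignment_set_literal[of "comp x" \<phi>]) simp
    have eq: "lit_val \<psi> z = lit_val \<phi> z" "lit_val \<chi> z = lit_val \<phi> z"
      if "z \<noteq> x" "z \<noteq> comp x" for z
      using p(2)[of z] n(2)[of z] that by (auto simp: lvar_eq_iff)
    have old: "\<exists>z\<in>E. z \<noteq> x \<and> z \<noteq> comp x \<and> lit_val \<phi> z" if "E \<in> F" "x \<notin> E" "comp x \<notin> E" for E
      using \<phi>[of E] DP_oldI[OF that] that by metis
    show False
    \<comment> \<open>If \<open>C\<close> is already satisfied without \<open>x\<close>, make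
      \<open>x\<close> false to satisfy the side clauses; otherwise make \<open>x\<close> true, and
      each resolvent must then be satisfied inside its side clause.\<close>
    proof (cases "\<exists>z\<in>C. z \<noteq> x \<and> lit_val \<phi> z")
      case True
      then obtain z where z: "z \<in> C" "z \<noteq> x" "lit_val \<phi> z" by blast
      then have "lit_val \<chi> z" using eq noclash C by blast
      then have "\<exists>z\<in>E. lit_val \<chi> z" if "E \<in> F" for E
        using that n(1) z C(3)[OF that] old[OF that] eq(2) by metis
      then show False using unsat by blast
    next
      case False
      have "\<exists>z\<in>E. lit_val \<psi> z" if E: "E \<in> F" for E
      proof (cases "comp x \<in> E")
        case True
        then have "?r E \<in> ?G" using E unfolding G by blast
        then obtain z where "z \<in> ?r E" "lit_val \<phi> z" using \<phi> by blast
        then have "z \<in> E" "lit_val \<psi> z" using False eq by auto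
        then show ?thesis by blast
      next
        case nx: False
        then show ?thesis using p(1) old[OF E] eq(1) by metis
      qed
      then show False using unsat by blast
    qed
  qed
  moreover have "satisfiable (?G - {R})" if R: "R \<in> ?G" for R
  proof (cases "R \<in> F")
    case True
    then obtain \<phi> where \<phi>: "\<And>E. E \<in> F \<Longrightarrow> E \<noteq> R \<Longrightarrow> \<exists>z\<in>E. lit_val \<phi> z"
      using MU unfolding MU_def satisfiable_def by (metis DiffI singletonD)
    have xR: "x \<notin> R" "comp x \<notin> R"
      using R DP_lit_notin[of R x] DP_lit_notin[of R "comp x"] by auto
    have "\<exists>z\<in>E. lit_val \<phi> z" if E: "E \<in> ?G" "E \<noteq> R" for E
    proof -
      consider "E \<in> F" | D where "D \<in> F" "comp x \<in> D" "E = ?r D" using E unfolding G by blast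
      then show ?thesis
      proof cases
        case 1
        then show ?thesis using \<phi> E by blast
      next
        case 2
        \<comment> \<open>Both parents differ from \<open>R\<close>, hence are satisfied; their true
          literals cannot be \<open>x\<close> and \<open>comp x\<close> at once, so one of them
          remains in the resolvent.\<close>
        obtain a where a: "a \<in> C" "lit_val \<phi> a" using \<phi>[OF C(1)] xR C(2) by blast
        obtain b where b: "b \<in> D" "lit_val \<phi> b" using \<phi>[OF 2(1)] xR 2 by blast
        have "a \<noteq> comp x" "b \<noteq> x" using a b C 2 noclash by blast+
        then show ?thesis using a b 2 by (cases "a = x"; cases "b = comp x") auto
      qed
    qed
    then show ?thesis unfolding satisfiable_def by blast
  next
    case False
    then obtain D where D: "D \<in> F" "comp x \<in> D" "R = ?r D" using R unfolding G by blast
    obtain \<phi> where \<phi>: "\<And>E. E \<in> F \<Longrightarrow> E \<noteq> D \<Longrightarrow> \<exists>z\<in>E. lit_val \<phi> z"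
      and fD: "\<And>z. z \<in> D \<Longrightarrow> \<not> lit_val \<phi> z"
      using main_clause_witness[OF MU x D(1,2)] by metis
    have "\<exists>z\<in>E. lit_val \<phi> z" if E: "E \<in> ?G" "E \<noteq> R" for E
    proof -
      consider "E \<in> F" "comp x \<notin> E" | D' where "D' \<in> F" "comp x \<in> D'" "E = ?r D'"
        using E unfolding G by blast
      then show ?thesis
      proof cases
        case 1
        then show ?thesis using \<phi> D by blast
      next
        case 2
        then obtain b where b: "b \<in> D'" "lit_val \<phi> b" using \<phi>[OF 2(1)] E D by blast
        \<comment> \<open>\<open>comp x\<close> is false because it lies in the falsified clause
          \<open>D\<close>, so the true literal of \<open>D'\<close> is not resolved away.\<close>
        moreover have "b \<noteq> x" "b \<noteq> comp x" using b 2 noclash fD[OF D(2)] by blast+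
        ultimately show ?thesis using 2 by blast
      qed
    qed
    then show ?thesis unfolding satisfiable_def by blast
  qed
  ultimately show ?thesis
    using is_clause_set_DP[OF MU_is_clause_set[OF MU]] unfolding MU_def by blast
qed

text \<open>Since \<open>y\<close> is not in \<open>C\<close>, resolving with \<open>C\<close>
  creates no further copies of \<open>y\<close>; its only occurrence \<open>E\<close> stays or is
  replaced by one resolvent.\<close>

lemma main_clause_DP:
  assumes MU: "MU F" and x: "main_clause F x C" and y: "main_clause F y E"
    and xy: "lvar x \<noteq> lvar y" and "y \<notin> C" "x \<notin> E"
  shows "\<exists>E'. main_clause (DP (lvar x) F) y E'"
proof -
  note G = DP_main_clause[OF MU x]
  let ?r = "\<lambda>D. (C \<union> D) - {x, comp x}"
  have ne: "y \<noteq> x" "y \<noteq> comp x" "comp y \<noteq> x" using xy by auto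
  note Ey = main_clauseD[OF y]
  define E' where "E' = (if comp x \<in> E then ?r E else E)"
  have "E' \<in> DP (lvar x) F" "y \<in> E'" using Ey(1,2) \<open>x \<notin> E\<close> ne unfolding E'_def G by auto
  moreover have "A = E'" if A: "A \<in> DP (lvar x) F" "y \<in> A" for A
  proof -
    consider "A \<in> F" "comp x \<notin> A" | D where "D \<in> F" "comp x \<in> D" "A = ?r D"
      using A(1) unfolding G by blast
    then show ?thesis
    proof cases
      case 1
      then show ?thesis using Ey(3) A(2) unfolding E'_def by auto
    next
      case 2
      then have "D = E" using Ey(3)[of D] A(2) \<open>y \<notin> C\<close> by blast
      then show ?thesis using 2 unfolding E'_def by simp
    qed
  qed
  ultimately have "{A \<in> DP (lvar x) F. y \<in> A} = {E'}" by blast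
  moreover have "\<exists>D\<in>DP (lvar x) F. comp y \<in> D"
  proof -
    obtain B where B: "B \<in> F" "comp y \<in> B" using y unfolding main_clause_def by blast
    obtain D where D: "D \<in> F" "comp x \<in> D" using x unfolding main_clause_def by blast
    \<comment> \<open>An occurrence of \<open>comp y\<close> is never lost: if \<open>B\<close> is
      the main clause \<open>C\<close>, every resolvent inherits it, and otherwise \<open>B\<close>
      survives itself or as a resolvent.\<close>
    consider "x \<in> B" | "comp x \<in> B" | "x \<notin> B" "comp x \<notin> B" by blast
    then show ?thesis
    proof cases
      case 1
      then have "B = C" using main_clauseD(3)[OF x B(1)] by simp
      then have "comp y \<in> ?r D" "?r D \<in> DP (lvar x) F" using B D ne unfolding G by auto
      then show ?thesis by (rule bexI)
    next
      case 2
      then have "comp y \<in> ?r B" "?r B \<in> DP (lvar x) F" using B ne unfolding G by auto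
      then show ?thesis by (rule bexI)
    next
      case 3
      then show ?thesis using B unfolding G by blast
    qed
  qed
  ultimately show ?thesis unfolding main_clause_def by blast
qed

text \<open>With two side clauses, a literal of \<open>C\<close> other than \<open>x\<close> is
  copied into two distinct resolvents and cannot have degree one afterwards. Outside
  \<open>C\<close> degrees are unchanged, because resolvents are pairwise distinct and new.\<close>

lemma main_clause_DP_old:
  assumes MU: "MU F" and x: "main_clause F x C"
    and D12: "D1 \<in> F" "comp x \<in> D1" "D2 \<in> F" "comp x \<in> D2" "D1 \<noteq> D2"
    and z: "main_clause (DP (lvar x) F) z E"
  shows "z \<notin> C \<and> lvar z \<noteq> lvar x \<and> (\<exists>E'. main_clause F z E')"
proof -
  note G = DP_main_clause[OF MU x]
  note E = main_clauseD[OF z]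
  let ?r = "\<lambda>D. (C \<union> D) - {x, comp x}"
  have r: "?r D \<in> DP (lvar x) F" if "D \<in> F" "comp x \<in> D" for D using that unfolding G by blast
  have zx: "z \<noteq> x" "z \<noteq> comp x"
    using E(1,2) DP_lit_notin[of E x] DP_lit_notin[of E "comp x"] by auto
  have zC: "z \<notin> C"
  proof
    assume "z \<in> C"
    then have "?r D1 = E" "?r D2 = E" using E(3) r D12 zx by blast+
    then show False using main_clause_resolvent_inj[OF MU x D12(1-4)] D12(5) by simp
  qed
  have "\<exists>E'. {B \<in> F. z \<in> B} = {E'}"
  proof (cases "E \<in> F")
    case True
    have "B = E" if B: "B \<in> F" "z \<in> B" for B
    proof (cases "comp x \<in> B")
      case True
      then have "?r B = E" using E(3)[OF r] B zx by blast
      then show ?thesis using main_clause_resolvent_new[OF MU x B(1) True] \<open>E \<in> F\<close> by simp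
    next
      case False
      moreover have "x \<notin> B" using main_clauseD(3)[OF x B(1)] B zC by blast
      ultimately show ?thesis using E(3) B unfolding G by blast
    qed
    then show ?thesis using True E(2) by blast
  next
    case False
    then obtain D where D: "D \<in> F" "comp x \<in> D" "E = ?r D" using E(1) unfolding G by blast
    have "B = D" if B: "B \<in> F" "z \<in> B" for B
    proof (cases "comp x \<in> B")
      case True
      then have "?r B = E" using E(3)[OF r] B zx by blast
      then show ?thesis using main_clause_resolvent_inj[OF MU x B(1) True D(1,2)] D by simp
    next
      case nB: False
      moreover have "x \<notin> B" using main_clauseD(3)[OF x B(1)] B zC by blast
      ultimately have "B = E" using E(3) B unfolding G by blast
      then show ?thesis using B False by simp
    qed
    moreover have "z \<in> D" using E(2) D zC by blast
    ultimately show ?thesis using D by blast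
  qed
  moreover have "\<exists>B\<in>F. comp z \<in> B"
  proof -
    obtain B where "B \<in> DP (lvar x) F" "comp z \<in> B" using z unfolding main_clause_def by blast
    then show ?thesis using main_clauseD(1)[OF x] unfolding G by blast
  qed
  ultimately show ?thesis using zC zx unfolding main_clause_def by (auto simp: lvar_eq_iff)
qed

section \<open>The normal forms\<close>

lemma sDP_step_main_clause:
  assumes "MU F" "main_clause F x C"
  shows "sDP_step F (DP (lvar x) F)"
  unfolding sDP_step_def using assms singular_iff_main_clause[OF MU_finite[OF assms(1)]] by blast

lemma sDP_stepE:
  assumes "sDP_step F G"
  obtains x C where "MU F" "main_clause F x C" "G = DP (lvar x) F"
  using assms unfolding sDP_step_def by (metis singular_iff_main_clause MU_finite)

lemma sDP_step_MU: "sDP_step F G \<Longrightarrow> MU G"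
  by (metis sDP_stepE MU_DP_main_clause)

lemma finite_vars: "is_clause_set F \<Longrightarrow> finite (vars F)"
  unfolding is_clause_set_def is_clause_def vars_def vars_cl_def by auto

text \<open>The eliminated variable disappears and none is added; this is the measure for the
  existence of normal forms and for the final induction.\<close>

lemma card_vars_sDP_step:
  assumes "sDP_step F G"
  shows "card (vars G) < card (vars F)"
  using assms
proof (rule sDP_stepE)
  fix x C assume MU: "MU F" and x: "main_clause F x C" and G: "G = DP (lvar x) F"
  have "lvar x \<notin> vars_cl A" if "A \<in> G" for A
    using that DP_lit_notin[of A x F] DP_lit_notin[of A "comp x" F]
    by (auto simp: lvar_in_vars_cl G)
  then have "lvar x \<notin> vars G" by (auto simp: vars_def)
  moreover have "vars G \<subseteq> vars F"
    unfolding vars_def vars_cl_def G DP_main_clause[OF MU x] using main_clauseD(1)[OF x] by fastforce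
  moreover have "lvar x \<in> vars F"
    using main_clauseD(1,2)[OF x] unfolding vars_def vars_cl_def by blast
  ultimately have "vars G \<subset> vars F" by blast
  then show ?thesis using finite_vars[OF MU_is_clause_set[OF MU]] psubset_card_mono by blast
qed

lemma sDP_step_subset: "sDP_step F G \<Longrightarrow> sDP G \<subseteq> sDP F"
  unfolding sDP_def by (auto intro: converse_rtranclp_into_rtranclp)

lemma sDP_nonempty: "MU F \<Longrightarrow> sDP F \<noteq> {}"
proof (induction "card (vars F)" arbitrary: F rule: less_induct)
  case less
  show ?case
  proof (cases "nonsingular F")
    case True
    then show ?thesis using less.prems unfolding sDP_def by auto
  next
    case False
    then obtain G where "sDP_step F G"
      using less.prems unfolding nonsingular_def sDP_step_def by blast
    then show ?thesis
      using less.hyps[OF card_vars_sDP_step sDP_step_MU] sDP_step_subset by blast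
  qed
qed

lemma sDP_cases:
  assumes "F' \<in> sDP F"
  obtains (refl) "F' = F" "nonsingular F"
  | (step) x C where "MU F" "main_clause F x C" "F' \<in> sDP (DP (lvar x) F)"
proof -
  have *: "sDP_step\<^sup>*\<^sup>* F F'" "nonsingular F'" "MU F'" using assms unfolding sDP_def by auto
  from *(1) show ?thesis
  proof (cases rule: converse_rtranclpE)
    case base
    then show ?thesis using * refl by simp
  next
    case (step G)
    then show ?thesis using that(2) * sDP_stepE[OF step(1)] unfolding sDP_def by blast
  qed
qed

lemma nonsingular_no_main_clause: "MU F \<Longrightarrow> nonsingular F \<longleftrightarrow> (\<nexists>x C. main_clause F x C)"
  unfolding nonsingular_def by (auto simp: singular_iff_main_clause[OF MU_finite])

lemma sDP_nonsingular: "nonsingular F \<Longrightarrow> F' \<in> sDP F \<Longrightarrow> F' = F"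
  by (erule sDP_cases) (auto simp: nonsingular_no_main_clause)

text \<open>Each literal stays singular after reducing the other, both orders lead to the same
  minimally unsatisfiable set, and any normal form of that set is common to both reducts.\<close>

lemma sDP_joinable:
  assumes MU: "MU F" and x: "main_clause F x C" and y: "main_clause F y E"
    and xy: "lvar x \<noteq> lvar y" and nin: "y \<notin> C" "x \<notin> E"
  shows "sDP (DP (lvar x) F) \<inter> sDP (DP (lvar y) F) \<noteq> {}"
proof -
  obtain E' where E': "main_clause (DP (lvar x) F) y E'"
    using main_clause_DP[OF MU x y xy nin] by blast
  obtain C' where C': "main_clause (DP (lvar y) F) x C'"
    using main_clause_DP[OF MU y x xy[symmetric] nin(2,1)] by blast
  note MUx = MU_DP_main_clause[OF MU x] and MUy = MU_DP_main_clause[OF MU y]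
  note MUxy = MU_DP_main_clause[OF MUx E'] and MUyx = MU_DP_main_clause[OF MUy C']
  have "DP (lvar y) (DP (lvar x) F) = DP (lvar x) (DP (lvar y) F)"
    using DP_commute_MU[OF MU_is_clause_set[OF MU] xy MUxy MUyx] .
  then show ?thesis
    using sDP_nonempty[OF MUxy] sDP_step_subset[OF sDP_step_main_clause[OF MUx E']]
      sDP_step_subset[OF sDP_step_main_clause[OF MUy C']] by auto
qed

section \<open>Isomorphism\<close>

lemma isomorphic_refl: "isomorphic F F"
  unfolding isomorphic_def by (rule exI[of _ id]) auto

lemma isomorphic_trans:
  assumes "isomorphic F G" "isomorphic G H"
  shows "isomorphic F H"
proof -
  obtain f where f: "bij f" "\<forall>x. f (comp x) = comp (f x)" "(\<lambda>C. f ` C) ` F = G"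
    using assms(1) unfolding isomorphic_def by blast
  obtain g where g: "bij g" "\<forall>x. g (comp x) = comp (g x)" "(\<lambda>C. g ` C) ` G = H"
    using assms(2) unfolding isomorphic_def by blast
  have "bij (g \<circ> f)" using f g bij_comp by blast
  moreover have "(\<lambda>C. (g \<circ> f) ` C) ` F = H" using f(3) g(3) by (auto simp: image_comp image_image)
  ultimately show ?thesis unfolding isomorphic_def using f(2) g(2) by (metis comp_apply)
qed

text \<open>
  If an assignment satisfies \<open>F\<close> after \<open>z\<close> has been added to \<open>E\<close>, then it makes \<open>z\<close> and \<open>y\<close> true,
  and making \<open>y\<close> false satisfies \<open>F\<close>.
\<close>

lemma saturated_common_literal:
  assumes sat: "saturated F" and E: "E \<in> F" "comp y \<in> E"
    and z: "z \<in> A" "A \<in> F" "z \<noteq> comp y" "z \<noteq> y" and all: "\<And>B. B \<in> F \<Longrightarrow> y \<in> B \<Longrightarrow> z \<in> B"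
  shows "z \<in> E \<or> comp z \<in> E"
proof (rule ccontr)
  assume nE: "\<not> (z \<in> E \<or> comp z \<in> E)"
  have unsat: "\<not> (\<forall>E\<in>F. \<exists>z\<in>E. lit_val \<phi> z)" for \<phi>
    using sat unfolding saturated_def MU_def satisfiable_def by blast
  have "lvar z \<in> vars F - vars_cl E"
    using nE z lvar_in_vars_cl[of z] by (auto simp: vars_def)
  then have "satisfiable ((F - {E}) \<union> {E \<union> {z}})" using sat E unfolding saturated_def by blast
  then obtain \<phi> where \<phi>: "\<And>B. B \<in> F \<Longrightarrow> B \<noteq> E \<Longrightarrow> \<exists>u\<in>B. lit_val \<phi> u"
    and \<phi>E: "\<exists>u\<in>E \<union> {z}. lit_val \<phi> u"
    unfolding satisfiable_def by auto
  have fE: "\<not> lit_val \<phi> u" if "u \<in> E" for u using unsat[of \<phi>] \<phi> that by blast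
  then have zt: "lit_val \<phi> z" using \<phi>E by blast
  obtain \<psi> where \<psi>: "lit_val \<psi> (comp y)" "\<And>z. lvar z \<noteq> lvar y \<Longrightarrow> lit_val \<psi> z = lit_val \<phi> z"
    by (rule assignment_set_literal[of "comp y" \<phi>]) simp
  have eq: "lit_val \<psi> u = lit_val \<phi> u" if "u \<noteq> y" "u \<noteq> comp y" for u
    using \<psi>(2)[of u] that by (auto simp: lvar_eq_iff)
  have "\<exists>u\<in>B. lit_val \<psi> u" if B: "B \<in> F" for B
  proof (cases "y \<in> B")
    case True
    then show ?thesis using all[OF B] eq zt z by blast
  next
    case False
    show ?thesis
    proof (cases "comp y \<in> B")
      case True
      then show ?thesis using \<psi>(1) by blast
    next
      case nB: False
      then show ?thesis using \<phi>[OF B] eq E False by metis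
    qed
  qed
  then show False using unsat by blast
qed

text \<open>After reducing on \<open>x\<close>, the clauses with \<open>y\<close> are exactly
  resolvents with \<open>C\<close>, so all contain each \<open>z\<close> in
  \<open>C - {x, y}\<close>. Saturation then puts \<open>z\<close> or \<open>comp z\<close> into
  \<open>E\<close>, and \<open>comp z\<close> would be a second clash with \<open>C\<close>.\<close>

lemma main_clause_subset_side_clause:
  assumes MU: "MU F" and x: "main_clause F x C" and y: "main_clause F y C" and xy: "x \<noteq> y"
    and sat: "saturated (DP (lvar x) F)" and E: "E \<in> F" "comp y \<in> E"
  shows "C - {x, y} \<subseteq> E"
proof
  fix z assume z: "z \<in> C - {x, y}"
  note G = DP_main_clause[OF MU x]
  let ?r = "\<lambda>D. (C \<union> D) - {x, comp x}"
  note noclash = clause_set_no_clash[OF MU_is_clause_set[OF MU]]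
  have nC: "comp x \<notin> C" "comp y \<notin> C" using noclash main_clauseD[OF x] main_clauseD[OF y] by blast+
  obtain D where D: "D \<in> F" "comp x \<in> D" using x unfolding main_clause_def by blast
  have clE: "C \<inter> comp ` E = {y}" using main_clause_clash[OF MU y E] .
  have "E \<noteq> C" using E nC by blast
  then have "x \<notin> E" using main_clauseD(3)[OF x E(1)] by blast
  moreover have "comp x \<notin> E" using clE main_clauseD(2)[OF x] xy by (auto simp: clash_iff)
  ultimately have EG: "E \<in> DP (lvar x) F" using E unfolding G by blast
  have DG: "?r D \<in> DP (lvar x) F" using D unfolding G by blast
  have zD: "z \<in> ?r D" using z nC by auto
  have all: "z \<in> B" if "B \<in> DP (lvar x) F" "y \<in> B" for B
    using that z nC main_clauseD[OF x] main_clauseD(3)[OF y] unfolding G by blast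
  have "z \<in> E \<or> comp z \<in> E"
    using saturated_common_literal[OF sat EG E(2) zD DG _ _ all] z nC by blast
  moreover have "comp z \<notin> E" using clE z by (auto simp: clash_iff)
  ultimately show "z \<in> E" by blast
qed

text \<open>As \<open>C - {x, y}\<close> lies in every side clause, a resolvent of \<open>C\<close>
  with a side clause of \<open>x\<close> only trades \<open>comp x\<close> for \<open>y\<close>, and
  one with a side clause of \<open>y\<close> only trades \<open>comp y\<close> for \<open>x\<close>.
  Exchanging these literals undoes one reduction and performs the other.\<close>

lemma isomorphic_saturated_reducts:
  assumes MU: "MU F" and x: "main_clause F x C" and y: "main_clause F y C"
    and xy: "lvar x \<noteq> lvar y"
    and satx: "saturated (DP (lvar x) F)" and saty: "saturated (DP (lvar y) F)"
  shows "isomorphic (DP (lvar x) F) (DP (lvar y) F)"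
proof -
  define f where "f z = (if z = y then comp x else if z = comp x then y
    else if z = comp y then x else if z = x then comp y else z)" for z
  have ne: "x \<noteq> y" "x \<noteq> comp y" "y \<noteq> comp x" "comp y \<noteq> x" "comp x \<noteq> y" using xy by auto
  note ne = ne ne(1)[symmetric]
  have ff: "f (f z) = z" for z unfolding f_def using ne by auto
  have bij: "bij f" by (rule o_bij[of f]) (auto simp: ff fun_eq_iff)
  have fc: "f (comp z) = comp (f z)" for z
    unfolding f_def using ne by (auto simp: comp_eq_comp_swap)
  have mem: "z \<in> f ` A \<longleftrightarrow> f z \<in> A" for z A by (metis ff image_iff)
  note noclash = clause_set_no_clash[OF MU_is_clause_set[OF MU]]
  note Cx = main_clauseD[OF x] and Cy = main_clauseD[OF y]
  have nC: "comp x \<notin> C" "comp y \<notin> C" using noclash Cx Cy by blast+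
  \<comment> \<open>Stated for both assignments of roles, so that the involution \<open>f\<close>
    yields both inclusions.\<close>
  have img: "f ` A \<in> DP (lvar b) F"
    if A: "A \<in> DP (lvar a) F" and ab: "(a = x \<and> b = y) \<or> (a = y \<and> b = x)" for A a b
  proof -
    have a: "main_clause F a C" and b: "main_clause F b C" and anb: "a \<noteq> b" "a \<noteq> comp b" "b \<noteq> comp a"
      and sa: "saturated (DP (lvar a) F)" and sb: "saturated (DP (lvar b) F)"
      using ab x y ne satx saty by auto
    have fa: "f a = comp b" "f (comp a) = b" "f b = comp a" "f (comp b) = a"
      and fo: "\<And>z. z \<noteq> a \<Longrightarrow> z \<noteq> b \<Longrightarrow> z \<noteq> comp a \<Longrightarrow> z \<noteq> comp b \<Longrightarrow> f z = z"
      using ab ne unfolding f_def by auto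
    note Ca = main_clauseD[OF a] and Cb = main_clauseD[OF b]
    have nCab: "comp a \<notin> C" "comp b \<notin> C" using ab nC by auto
    note Ga = DP_main_clause[OF MU a] and Gb = DP_main_clause[OF MU b]
    have subE: "C - {a, b} \<subseteq> E" if "E \<in> F" "comp b \<in> E" for E
      using main_clause_subset_side_clause[OF MU a b anb(1) sa that] .
    have subD: "C - {a, b} \<subseteq> D" if "D \<in> F" "comp a \<in> D" for D
      using main_clause_subset_side_clause[OF MU b a anb(1)[symmetric] sb that] by blast
    \<comment> \<open>A clause surviving the reduction on \<open>a\<close> cannot contain
      \<open>b\<close>, whose only occurrence is in \<open>C\<close> together with
      \<open>a\<close>.\<close>
    consider "A \<in> F" "a \<notin> A" "comp a \<notin> A" "b \<notin> A" "comp b \<notin> A"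
      | "A \<in> F" "a \<notin> A" "comp a \<notin> A" "comp b \<in> A" "b \<notin> A"
      | D where "D \<in> F" "comp a \<in> D" "A = (C \<union> D) - {a, comp a}"
      using A Ca(2) Cb(3)[of A] unfolding Ga by blast
    then show ?thesis
    proof cases
      case 1
      then have "f ` A = A" using fo by (auto simp: set_eq_iff mem) (metis fa ff fo)+
      then show ?thesis using 1 unfolding Gb by simp
    next
      case 2
      \<comment> \<open>\<open>f\<close> turns \<open>comp b\<close> into \<open>a\<close>, which is
        all that \<open>C\<close> contributes to this resolvent.\<close>
      have "f ` A = (C \<union> A) - {b, comp b}"
      proof (rule set_eqI)
        fix z
        consider "z = a" | "z = comp a" | "z = b" | "z = comp b"
          | "z \<noteq> a" "z \<noteq> b" "z \<noteq> comp a" "z \<noteq> comp b" by blast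
        then show "z \<in> f ` A \<longleftrightarrow> z \<in> (C \<union> A) - {b, comp b}"
          using 2 subE[of A] fa fo Ca(2) nCab anb by cases (auto simp: mem)
      qed
      then show ?thesis using 2 unfolding Gb by blast
    next
      case 3
      have cl: "C \<inter> comp ` D = {a}" using main_clause_clash[OF MU a 3(1,2)] .
      have "comp b \<notin> D" using cl Cb(2) anb by (auto simp: clash_iff)
      moreover have "b \<notin> D" using Cb(3)[OF 3(1)] 3(2) nCab by blast
      moreover have "a \<notin> D" using Ca(3)[OF 3(1)] 3(2) nCab by blast
      ultimately have D: "comp b \<notin> D" "b \<notin> D" "a \<notin> D" .
      \<comment> \<open>Conversely \<open>f\<close> turns the \<open>b\<close> inherited from
        \<open>C\<close> back into the \<open>comp a\<close> that was resolved away.\<close>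
      have "f ` A = D"
      proof (rule set_eqI)
        fix z
        consider "z = a" | "z = comp a" | "z = b" | "z = comp b"
          | "z \<noteq> a" "z \<noteq> b" "z \<noteq> comp a" "z \<noteq> comp b" by blast
        then show "z \<in> f ` A \<longleftrightarrow> z \<in> D"
          using 3 D subD[of D] fa fo Cb(2) nCab anb by cases (auto simp: mem)
      qed
      then show ?thesis using 3 D unfolding Gb by blast
    qed
  qed
  have "(\<lambda>A. f ` A) ` DP (lvar x) F = DP (lvar y) F"
  proof (intro equalityI subsetI)
    fix B assume B: "B \<in> DP (lvar y) F"
    have "f ` f ` B = B" by (simp add: image_image ff)
    then show "B \<in> (\<lambda>A. f ` A) ` DP (lvar x) F" using img[OF B, of x] by (metis image_eqI)
  qed (use img in blast)
  then show ?thesis unfolding isomorphic_def using bij fc by blast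
qed

section \<open>Critical pairs and the confluence induction\<close>

lemma side_clauses_or_main_comp:
  assumes "main_clause F x C"
  obtains (one) D where "main_clause F (comp x) D"
  | (two) D1 D2 where "D1 \<in> F" "comp x \<in> D1" "D2 \<in> F" "comp x \<in> D2" "D1 \<noteq> D2"
proof -
  obtain D where D: "D \<in> F" "comp x \<in> D" using assms unfolding main_clause_def by blast
  show ?thesis
  proof (cases "\<exists>D'\<in>F. comp x \<in> D' \<and> D' \<noteq> D")
    case True
    then show ?thesis using two D by blast
  next
    case False
    then have "{E \<in> F. comp x \<in> E} = {D}" using D by blast
    then show ?thesis using one main_clauseD[OF assms] unfolding main_clause_def by auto
  qed
qed

text \<open>By \<open>main_clause_DP_old\<close>, \<open>z\<close> was already singular in
  \<open>F\<close> and lies outside \<open>C\<close>. Its main clause therefore differs from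
  \<open>C\<close> and contains neither \<open>x\<close> nor \<open>y\<close>, so both joins are
  available.\<close>

lemma singular_after_joinable_with_both:
  assumes MU: "MU F" and x: "main_clause F x C" and y: "main_clause F y C"
    and D: "D1 \<in> F" "comp x \<in> D1" "D2 \<in> F" "comp x \<in> D2" "D1 \<noteq> D2"
    and E: "E1 \<in> F" "comp y \<in> E1" "E2 \<in> F" "comp y \<in> E2" "E1 \<noteq> E2"
    and z: "main_clause (DP (lvar x) F) z B"
  obtains u U where "main_clause F u U"
    "sDP (DP (lvar u) F) \<inter> sDP (DP (lvar x) F) \<noteq> {}"
    "sDP (DP (lvar u) F) \<inter> sDP (DP (lvar y) F) \<noteq> {}"
proof -
  obtain U where zC: "z \<notin> C" and zx: "lvar z \<noteq> lvar x" and U: "main_clause F z U"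
    using main_clause_DP_old[OF MU x D z] by blast
  have "U \<noteq> C" using zC main_clauseD(2)[OF U] by blast
  then have nU: "x \<notin> U" "y \<notin> U"
    using main_clauseD(3)[OF x] main_clauseD(3)[OF y] main_clauseD(1)[OF U] by blast+
  have "z \<noteq> y" using zC main_clauseD(2)[OF y] by blast
  moreover have "z \<noteq> comp y" using main_clauseD(3)[OF U] E by blast
  ultimately have zy: "lvar z \<noteq> lvar y" by (auto simp: lvar_eq_iff)
  show ?thesis
    using that[OF U] sDP_joinable[OF MU U x zx nU(1) zC] sDP_joinable[OF MU U y zy nU(2) zC] by blast
qed

theorem theorem71:
  fixes F :: "'v cls"
  assumes "MU F"
    and "\<forall>F'\<in>sDP F. saturated F'"
    and "F' \<in> sDP F" and "F'' \<in> sDP F"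
  shows "isomorphic F' F''"
  using assms
proof (induction "card (vars F)" arbitrary: F F' F'' rule: less_induct)
  case less
  note MU = \<open>MU F\<close>
  \<comment> \<open>Eventual saturation passes to a reduct because its normal forms are among those
    of \<open>F\<close>.\<close>
  have IH: "isomorphic A B"
    if "main_clause F x C" "A \<in> sDP (DP (lvar x) F)" "B \<in> sDP (DP (lvar x) F)" for x C A B
    using less.hyps[of "DP (lvar x) F" A B] that sDP_step_main_clause[OF MU that(1)]
      MU_DP_main_clause[OF MU that(1)] card_vars_sDP_step sDP_step_subset less.prems(2)
    by blast
  have join: "isomorphic A B"
    if xy: "main_clause F x C" "main_clause F y E" "lvar x \<noteq> lvar y" "y \<notin> C" "x \<notin> E"
      and AB: "A \<in> sDP (DP (lvar x) F)" "B \<in> sDP (DP (lvar y) F)" for x y C E A B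
  proof -
    obtain N where "N \<in> sDP (DP (lvar x) F)" "N \<in> sDP (DP (lvar y) F)"
      using sDP_joinable[OF MU xy] by blast
    then show ?thesis using IH xy(1,2) AB isomorphic_trans by blast
  qed
  show ?case
    using \<open>F' \<in> sDP F\<close>
  proof (cases rule: sDP_cases)
    case refl
    then show ?thesis using sDP_nonsingular less.prems isomorphic_refl by blast
  next
    case (step x C)
    note x = step(2) and F' = step(3)
    have "\<not> nonsingular F" using x nonsingular_no_main_clause[OF MU] by blast
    with \<open>F'' \<in> sDP F\<close> obtain y E where y: "main_clause F y E" and F'': "F'' \<in> sDP (DP (lvar y) F)"
      by (cases rule: sDP_cases) auto
    show ?thesis
    proof (cases "lvar x = lvar y \<or> (y \<notin> C \<and> x \<notin> E)")
      case True
      then show ?thesis using IH[OF x F'] join[OF x y _ _ _ F' F''] F'' by metis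
    next
      case False
      then have xy: "lvar x \<noteq> lvar y" and "y \<in> C \<or> x \<in> E" by auto
      \<comment> \<open>A degree-one literal occurring in the other's main clause forces the two
        main clauses to coincide.\<close>
      then have EC: "E = C" using main_clauseD[OF x] main_clauseD[OF y] by blast
      note yC = y[unfolded EC]
      note noclash = clause_set_no_clash[OF MU_is_clause_set[OF MU]]
      have nC: "comp x \<notin> C" "comp y \<notin> C"
        using noclash main_clauseD[OF x] main_clauseD[OF yC] by blast+
      from x show ?thesis
      proof (cases rule: side_clauses_or_main_comp)
        case (one D)
        \<comment> \<open>If \<open>comp x\<close> also has degree one, it may replace
          \<open>x\<close> as the singular literal of the same variable; its main clause
          \<open>D\<close> differs from \<open>C\<close>, which removes the obstruction.\<close>
        have "y \<notin> D" using main_clauseD[OF one] main_clauseD(3)[OF yC] nC by blast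
        then show ?thesis using join[OF one yC] xy nC F' F'' by simp
      next
        case D: (two D1 D2)
        from yC show ?thesis
        proof (cases rule: side_clauses_or_main_comp)
          case (one D)
          have "x \<notin> D" using main_clauseD[OF one] main_clauseD(3)[OF x] nC by blast
          then show ?thesis using join[OF x one] xy nC F' F'' by simp
        next
          case E: (two E1 E2)
          note MUx = MU_DP_main_clause[OF MU x] and MUy = MU_DP_main_clause[OF MU yC]
          show ?thesis
          proof (cases "nonsingular (DP (lvar x) F) \<and> nonsingular (DP (lvar y) F)")
            case True
            \<comment> \<open>Nonsingular reducts are their own only normal forms, so the saturation
              hypothesis applies to them directly.\<close>
            then have eq: "F' = DP (lvar x) F" "F'' = DP (lvar y) F"
              using sDP_nonsingular F' F'' by blast+
            then have "saturated (DP (lvar x) F)" "saturated (DP (lvar y) F)"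
              using less.prems by auto
            then show ?thesis using isomorphic_saturated_reducts[OF MU x yC xy] eq by simp
          next
            case False
            then obtain u U where u: "main_clause F u U"
              "sDP (DP (lvar u) F) \<inter> sDP (DP (lvar x) F) \<noteq> {}"
              "sDP (DP (lvar u) F) \<inter> sDP (DP (lvar y) F) \<noteq> {}"
              using nonsingular_no_main_clause[OF MUx] nonsingular_no_main_clause[OF MUy]
                singular_after_joinable_with_both[OF MU x yC D E]
                singular_after_joinable_with_both[OF MU yC x E D] by metis
            \<comment> \<open>The induction hypothesis for the reducts on \<open>x\<close>,
              \<open>u\<close> and \<open>y\<close> links \<open>F'\<close> to \<open>N1\<close>,
              \<open>N1\<close> to \<open>N2\<close>, and \<open>N2\<close> to
              \<open>F''\<close>.\<close>
            then obtain N1 N2 where "N1 \<in> sDP (DP (lvar u) F)" "N1 \<in> sDP (DP (lvar x) F)"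
              "N2 \<in> sDP (DP (lvar u) F)" "N2 \<in> sDP (DP (lvar y) F)" by blast
            then show ?thesis using IH u(1) x y F' F'' isomorphic_trans by meson
          qed
        qed
      qed
    qed
  qed
qed

end
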